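(* For any permutation $\sigma\in\mathrm{Sym}(n)$, the cyclic group $G=\langle\sigma\rangle\le\mathrm{Sym}(n)$, with its natural action on $[n]=\{1,\dots,n\}$, has the strict EKR property.
   Context: Let $G\le \mathrm{Sym}(n)$ act naturally on $[n]$. Two permutations $\pi,\sigma\in G$ intersect if $\pi\sigma^{-1}$ fixes some point of $[n]$; a subset of $G$ is intersecting if every pair of its elements intersect. $G$ has the EKR property if every intersecting subset of $G$ has size at most the size of the largest point-stabilizer $G_x$ ($x\in[n]$). $G$ has the strict EKR property if it has the EKR property and every intersecting subset of $G$ of maximum size is a coset of a point-stabilizer, i.e. a set of the form $\{\pi\in G:\pi(i)=j\}$ for some $i,j\in[n]$. *)

theory Defs
  imports "HOL-Algebra.Sym_Groups"
begin

text \<open>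
  Throughout, \<open>G\<close> is (the carrier of) a subgroup of \<open>sym_group n\<close>, the group of permutations
  of \<open>{1..n}\<close> under composition.
\<close>

definition perms_intersect :: "nat \<Rightarrow> (nat \<Rightarrow> nat) \<Rightarrow> (nat \<Rightarrow> nat) \<Rightarrow> bool" where
  "perms_intersect n \<pi> \<sigma> \<longleftrightarrow>
     (\<exists>x\<in>{1..n}. (\<pi> \<otimes>\<^bsub>sym_group n\<^esub> inv\<^bsub>sym_group n\<^esub> \<sigma>) x = x)"

definition intersecting :: "nat \<Rightarrow> (nat \<Rightarrow> nat) set \<Rightarrow> bool" where
  "intersecting n S \<longleftrightarrow> (\<forall>\<pi>\<in>S. \<forall>\<sigma>\<in>S. perms_intersect n \<pi> \<sigma>)"

definition point_stabilizer :: "(nat \<Rightarrow> nat) set \<Rightarrow> nat \<Rightarrow> (nat \<Rightarrow> nat) set" where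
  "point_stabilizer G x = {\<pi> \<in> G. \<pi> x = x}"

text \<open>The maximum below is over a nonempty set only if \<open>n \<ge> 1\<close>.\<close>

definition EKR_property :: "nat \<Rightarrow> (nat \<Rightarrow> nat) set \<Rightarrow> bool" where
  "EKR_property n G \<longleftrightarrow>
     (\<forall>S\<subseteq>G. intersecting n S \<longrightarrow>
        card S \<le> Max ((\<lambda>x. card (point_stabilizer G x)) ` {1..n}))"

definition max_intersecting :: "nat \<Rightarrow> (nat \<Rightarrow> nat) set \<Rightarrow> (nat \<Rightarrow> nat) set \<Rightarrow> bool" where
  "max_intersecting n G S \<longleftrightarrow>
     S \<subseteq> G \<and> intersecting n S \<and> (\<forall>T\<subseteq>G. intersecting n T \<longrightarrow> card T \<le> card S)"

definition strict_EKR_property :: "nat \<Rightarrow> (nat \<Rightarrow> nat) set \<Rightarrow> bool" where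
  "strict_EKR_property n G \<longleftrightarrow>
     EKR_property n G \<and>
     (\<forall>S. max_intersecting n G S \<longrightarrow>
        (\<exists>i\<in>{1..n}. \<exists>j\<in>{1..n}. S = {\<pi> \<in> G. \<pi> i = j}))"

end

theory Submission
  imports Defs "HOL-Algebra.Multiplicative_Group"
begin

text \<open>
  Let \<open>r\<close> be the length of a shortest cycle of \<open>\<sigma>\<close>, so that \<open>\<sigma>\<^sup>k\<close> is fixed-point free for
  \<open>0 < k < r\<close>. For an intersecting set \<open>S\<close> the translates \<open>S, \<sigma>S, \<dots>, \<sigma>\<^bsup>r-1\<^esup>S\<close> are therefore
  pairwise disjoint, whence \<open>r |S| \<le> |G|\<close>, and the stabilizer of a point of a shortest cycle
  attains this bound. If \<open>S\<close> is of maximum size, the translates tile \<open>G\<close>. For \<open>\<pi> \<in> S\<close> the tile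
  containing \<open>\<sigma>\<^sup>r\<pi>\<close> can only be \<open>S\<close> itself, since \<open>\<sigma>\<^sup>r\<pi> = \<sigma>\<^sup>j\<pi>'\<close> with \<open>0 < j < r\<close> would make
  \<open>\<pi>\<close> and \<open>\<pi>' = \<sigma>\<^bsup>r-j\<^esup>\<pi>\<close> disjoint. Hence \<open>S\<close> is a union of cosets of \<open>\<langle>\<sigma>\<^sup>r\<rangle>\<close>, which is that
  stabilizer, and by its size it is a single coset.
\<close>

section \<open>Intersection and cyclic subgroups in \<open>sym_group n\<close>\<close>

lemma perms_intersect_iff:
  assumes "\<pi> permutes {1..n}" "\<tau> permutes {1..n}"
  shows "perms_intersect n \<pi> \<tau> \<longleftrightarrow> (\<exists>x\<in>{1..n}. \<pi> x = \<tau> x)"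
proof -
  have inv: "inv\<^bsub>sym_group n\<^esub> \<tau> = inv' \<tau>"
    using assms(2) by (simp add: sym_group_carrier)
  \<comment> \<open>A fixed point \<open>x\<close> on the left corresponds to the point
    \<open>inv' \<tau> x\<close> of agreement on the right.\<close>
  have "(\<exists>x\<in>{1..n}. \<pi> (inv' \<tau> x) = x) \<longleftrightarrow> (\<exists>x\<in>{1..n}. \<pi> x = \<tau> x)"
    by (metis assms(2) permutes_in_image permutes_inv permutes_inverses)
  then show ?thesis
    by (simp add: perms_intersect_def inv sym_group_mult)
qed

lemma sym_group_pow: "\<sigma> [^]\<^bsub>sym_group n\<^esub> (k::nat) = \<sigma> ^^ k"
  by (induction k) (simp_all add: nat_pow_def sym_group_one sym_group_mult funpow_swap1 fun_eq_iff)

lemma finite_carrier_sym_group: "finite (carrier (sym_group n))"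
  by (simp add: sym_group_def finite_permutations)

text \<open>In a finite group inverses are themselves powers with natural exponents.\<close>

lemma generate_sym_group_singleton:
  assumes "\<sigma> \<in> carrier (sym_group n)"
  shows "generate (sym_group n) {\<sigma>} = range (\<lambda>k. \<sigma> ^^ k)"
  using group.generate_pow_on_finite_carrier[OF sym_group_is_group finite_carrier_sym_group assms]
  by (auto simp: sym_group_pow)

text \<open>Since \<open>no_fixpoint\<close> ranges over all points, \<open>r\<close> is minimal
  among all cycles of \<open>\<sigma>\<close>; the cycle of \<open>i\<close> attains it.\<close>

locale shortest_cycle =
  fixes n :: nat and \<sigma> :: "nat \<Rightarrow> nat" and r i :: nat
  assumes perm: "\<sigma> permutes {1..n}"
    and i_mem: "i \<in> {1..n}"
    and r_pos: "0 < r"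
    and period: "(\<sigma> ^^ r) i = i"
    and no_fixpoint: "\<And>k x. 0 < k \<Longrightarrow> k < r \<Longrightarrow> x \<in> {1..n} \<Longrightarrow> (\<sigma> ^^ k) x \<noteq> x"
begin

abbreviation powers :: "(nat \<Rightarrow> nat) set" where
  "powers \<equiv> range (\<lambda>k. \<sigma> ^^ k)"

abbreviation stab :: "(nat \<Rightarrow> nat) set" where
  "stab \<equiv> point_stabilizer powers i"

section \<open>Arithmetic of the powers of \<open>\<sigma>\<close>\<close>

lemma permutes_powers: "\<pi> \<in> powers \<Longrightarrow> \<pi> permutes {1..n}"
  using perm permutes_funpow by auto

lemma finite_powers: "finite powers"
  by (rule finite_subset[OF _ finite_permutations[of "{1..n}"]]) (use permutes_powers in auto)

lemma comp_powers: "\<pi> \<in> powers \<Longrightarrow> \<tau> \<in> powers \<Longrightarrow> \<pi> \<circ> \<tau> \<in> powers"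
  by (auto simp flip: funpow_add)

lemma comp_powers_commute: "\<pi> \<in> powers \<Longrightarrow> \<tau> \<in> powers \<Longrightarrow> \<pi> (\<tau> x) = \<tau> (\<pi> x)"
  by (auto simp: add.commute simp flip: funpow_add comp_apply[of "\<sigma> ^^ _" "\<sigma> ^^ _"])

lemma powers_translate:
  assumes "\<pi> \<in> powers" "\<tau> \<in> powers"
  obtains m where "\<pi> = \<sigma> ^^ m \<circ> \<tau>"
proof -
  obtain N where N: "\<sigma> ^^ N = id" "N > 0"
    using permutation_is_nilpotent perm permutation_permutes by blast
  obtain a b where ab: "\<pi> = \<sigma> ^^ a" "\<tau> = \<sigma> ^^ b"
    using assms by auto
  \<comment> \<open>The inverse of \<open>\<sigma> ^^ b\<close> is
    \<open>\<sigma> ^^ (N * b - b)\<close>; the inequality keeps the subtraction of naturals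
    exact.\<close>
  have "b \<le> N * b"
    using N by simp
  then have "\<sigma> ^^ (a + (N * b - b)) \<circ> \<tau> = \<sigma> ^^ (a + N * b)"
    unfolding ab funpow_add[symmetric] by (metis add.assoc le_add_diff_inverse2)
  also have "\<dots> = \<pi>"
    using N by (simp add: ab funpow_add flip: funpow_mult)
  finally show ?thesis
    using that by metis
qed

text \<open>The power with exponent \<open>m mod r\<close> fixes \<open>i\<close> too, so minimality
  of \<open>r\<close> makes the remainder zero.\<close>

lemma fixes_i_dvd:
  assumes "(\<sigma> ^^ m) i = i"
  shows "r dvd m"
proof -
  have "(\<sigma> ^^ (m mod r)) i = i"
    using assms by (simp add: funpow_mod_eq[OF period])
  then have "m mod r = 0"
    using no_fixpoint[OF _ _ i_mem] r_pos by (metis mod_less_divisor neq0_conv)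
  then show ?thesis
    by auto
qed

section \<open>Packing bound for intersecting sets\<close>

lemma intersecting_no_shift:
  assumes S: "S \<subseteq> powers" "intersecting n S"
    and "\<pi> \<in> S" "\<tau> \<in> S" "\<pi> = \<sigma> ^^ k \<circ> \<tau>" "k < r"
  shows "k = 0"
proof -
  have perms: "\<pi> permutes {1..n}" "\<tau> permutes {1..n}"
    using assms permutes_powers by blast+
  obtain x where x: "x \<in> {1..n}" "\<pi> x = \<tau> x"
    using assms(2-4) perms_intersect_iff[OF perms] unfolding intersecting_def by blast
  have "\<tau> x \<in> {1..n}"
    using perms x permutes_in_image by metis
  \<comment> \<open>Agreement at \<open>x\<close> becomes a fixed point of the shift at
    \<open>\<tau> x\<close>.\<close>
  moreover have "(\<sigma> ^^ k) (\<tau> x) = \<tau> x"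
    using x assms by simp
  ultimately show ?thesis
    using no_fixpoint \<open>k < r\<close> by blast
qed

lemma inj_on_translates:
  assumes "S \<subseteq> powers" "intersecting n S"
  shows "inj_on (\<lambda>(j, \<pi>). \<sigma> ^^ j \<circ> \<pi>) ({..<r} \<times> S)"
proof -
  have *: "j = k \<and> \<pi> = \<tau>"
    if "j \<le> k" "k < r" "\<pi> \<in> S" "\<tau> \<in> S" "\<sigma> ^^ j \<circ> \<pi> = \<sigma> ^^ k \<circ> \<tau>" for j k \<pi> \<tau>
  proof -
    have "inj (\<sigma> ^^ j)"
      using permutes_inj permutes_funpow perm by blast
    moreover have "\<sigma> ^^ j \<circ> \<pi> = \<sigma> ^^ j \<circ> (\<sigma> ^^ (k - j) \<circ> \<tau>)"
      using that by (simp flip: o_assoc add: o_assoc funpow_add[symmetric])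
    ultimately have eq: "\<pi> = \<sigma> ^^ (k - j) \<circ> \<tau>"
      by (auto simp: fun_eq_iff dest: injD)
    then have "k - j = 0"
      using intersecting_no_shift[OF assms \<open>\<pi> \<in> S\<close> \<open>\<tau> \<in> S\<close> eq] \<open>k < r\<close> by simp
    then show ?thesis
      using eq that by simp
  qed
  \<comment> \<open>By symmetry the smaller of the two shifts may be taken as
    \<open>j\<close>.\<close>
  show ?thesis
    by (rule inj_onI) (auto, (metis * nat_le_linear)+)
qed

lemma card_intersecting_le:
  assumes "S \<subseteq> powers" "intersecting n S"
  shows "r * card S \<le> card powers"
proof -
  have "card ({..<r} \<times> S) \<le> card powers"
    by (rule card_inj_on_le[OF inj_on_translates[OF assms] _ finite_powers])
       (use assms comp_powers in auto)
  then show ?thesis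
    by (simp only: card_cartesian_product card_lessThan)
qed

text \<open>Division with remainder: \<open>\<sigma> ^^ m\<close> splits into a shift by
  \<open>m mod r\<close> after a power of \<open>\<sigma> ^^ r\<close>, and the latter fixes
  \<open>i\<close>.\<close>

lemma card_powers_le: "card powers \<le> r * card stab"
proof -
  have fin: "finite stab"
    using finite_powers by (simp add: point_stabilizer_def)
  have "powers \<subseteq> (\<lambda>(j, \<pi>). \<sigma> ^^ j \<circ> \<pi>) ` ({..<r} \<times> stab)"
  proof
    fix \<pi> assume "\<pi> \<in> powers"
    then obtain m where m: "\<pi> = \<sigma> ^^ m"
      by auto
    have "(\<sigma> ^^ (r * (m div r))) i = i"
      using funpow_mod_eq[OF period, of "r * (m div r)"] by simp
    then have "\<sigma> ^^ (r * (m div r)) \<in> stab"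
      by (auto simp: point_stabilizer_def)
    moreover have "\<pi> = \<sigma> ^^ (m mod r) \<circ> \<sigma> ^^ (r * (m div r))"
      by (simp add: m flip: funpow_add)
    ultimately show "\<pi> \<in> (\<lambda>(j, \<pi>). \<sigma> ^^ j \<circ> \<pi>) ` ({..<r} \<times> stab)"
      using r_pos by (intro image_eqI[of _ _ "(m mod r, \<sigma> ^^ (r * (m div r)))"]) auto
  qed
  then have "card powers \<le> card ({..<r} \<times> stab)"
    by (rule surj_card_le[rotated]) (use fin in simp)
  then show ?thesis
    by (simp only: card_cartesian_product card_lessThan)
qed

lemma card_intersecting_le_stab:
  assumes "S \<subseteq> powers" "intersecting n S"
  shows "card S \<le> card stab"
  using card_intersecting_le[OF assms] card_powers_le r_pos
  by (meson le_trans nat_mult_le_cancel1)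

lemma intersecting_stab: "intersecting n stab"
  unfolding intersecting_def
proof (intro ballI)
  fix \<pi> \<tau> assume "\<pi> \<in> stab" "\<tau> \<in> stab"
  then have "\<pi> \<in> powers" "\<tau> \<in> powers" "\<pi> i = \<tau> i"
    by (auto simp: point_stabilizer_def)
  then show "perms_intersect n \<pi> \<tau>"
    using i_mem permutes_powers perms_intersect_iff by blast
qed

lemma EKR_powers: "EKR_property n powers"
  unfolding EKR_property_def
proof (intro allI impI)
  fix S assume "S \<subseteq> powers" "intersecting n S"
  then have "card S \<le> card stab"
    by (rule card_intersecting_le_stab)
  also have "\<dots> \<le> Max ((\<lambda>x. card (point_stabilizer powers x)) ` {1..n})"
    using i_mem by (intro Max_ge) auto
  finally show "card S \<le> Max ((\<lambda>x. card (point_stabilizer powers x)) ` {1..n})" .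
qed

section \<open>Intersecting sets of maximum size\<close>

lemma max_intersecting_shift:
  assumes S: "S \<subseteq> powers" "intersecting n S" and card: "card S = card stab"
    and "\<pi> \<in> S"
  shows "\<sigma> ^^ r \<circ> \<pi> \<in> S"
proof -
  let ?f = "\<lambda>(j, \<pi>). \<sigma> ^^ j \<circ> \<pi>"
  \<comment> \<open>The translates are disjoint and \<open>r * card S\<close> reaches
    \<open>card powers\<close>, so they tile the group.\<close>
  have "?f ` ({..<r} \<times> S) = powers"
  proof (rule card_seteq[OF finite_powers])
    show "?f ` ({..<r} \<times> S) \<subseteq> powers"
      using S comp_powers by auto
    show "card powers \<le> card (?f ` ({..<r} \<times> S))"
      using card_powers_le by (simp add: card_image[OF inj_on_translates[OF S]] card card_cartesian_product)
  qed
  moreover have "\<sigma> ^^ r \<circ> \<pi> \<in> powers"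
    using assms comp_powers by blast
  ultimately obtain j \<tau> where j: "j < r" "\<tau> \<in> S" "\<sigma> ^^ r \<circ> \<pi> = \<sigma> ^^ j \<circ> \<tau>"
    by (smt (verit) SigmaE case_prod_conv imageE lessThan_iff)
  have "inj (\<sigma> ^^ j)"
    using permutes_inj permutes_funpow perm by blast
  moreover have "\<sigma> ^^ j \<circ> (\<sigma> ^^ (r - j) \<circ> \<pi>) = \<sigma> ^^ j \<circ> \<tau>"
    using j by (simp add: o_assoc funpow_add[symmetric])
  ultimately have "\<tau> = \<sigma> ^^ (r - j) \<circ> \<pi>"
    by (simp add: fun_eq_iff inj_eq)
  \<comment> \<open>For \<open>j > 0\<close> the shift \<open>r - j\<close> lies strictly between 0
    and \<open>r\<close>, which is impossible within \<open>S\<close>.\<close>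
  then have "j = 0"
    using intersecting_no_shift[OF S \<open>\<tau> \<in> S\<close> \<open>\<pi> \<in> S\<close>, of "r - j"] j by fastforce
  then show ?thesis
    using j by simp
qed

text \<open>Closure under \<open>\<sigma> ^^ r\<close> puts the whole coset \<open>?C\<close> of
  some \<open>s\<close> in \<open>S\<close> inside \<open>S\<close>; comparing sizes gives
  equality.\<close>

lemma max_intersecting_coset:
  assumes "max_intersecting n powers S"
  shows "\<exists>j\<in>{1..n}. S = {\<pi> \<in> powers. \<pi> i = j}"
proof -
  have S: "S \<subseteq> powers" "intersecting n S"
    and max: "\<And>T. T \<subseteq> powers \<Longrightarrow> intersecting n T \<Longrightarrow> card T \<le> card S"
    using assms by (auto simp: max_intersecting_def)
  have finS: "finite S"
    using S finite_powers finite_subset by blast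
  have "stab \<subseteq> powers"
    by (auto simp: point_stabilizer_def)
  then have card: "card S = card stab"
    using max intersecting_stab card_intersecting_le_stab[OF S] by (simp add: le_antisym)
  \<comment> \<open>Nonemptiness of \<open>stab\<close> passes to \<open>S\<close> through
    \<open>card\<close>.\<close>
  have "id \<in> stab"
    by (auto simp: point_stabilizer_def intro: range_eqI[of _ _ 0])
  then have "card stab \<noteq> 0"
    using finite_subset[OF \<open>stab \<subseteq> powers\<close> finite_powers] by auto
  then obtain s where s: "s \<in> S"
    using card by fastforce
  then have sp: "s \<in> powers" "s permutes {1..n}"
    using S permutes_powers by auto
  let ?C = "{\<pi> \<in> powers. \<pi> i = s i}"
  have shift: "\<sigma> ^^ (r * q) \<circ> s \<in> S" for q
  proof (induction q)
    case (Suc q)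
    then show ?case
      using max_intersecting_shift[OF S card] by (metis funpow_add o_assoc mult_Suc_right)
  qed (simp add: s)
  have "?C \<subseteq> S"
  proof
    fix \<pi> assume \<pi>: "\<pi> \<in> ?C"
    then obtain m where m: "\<pi> = \<sigma> ^^ m \<circ> s"
      using powers_translate sp by blast
    \<comment> \<open>Commutativity moves the shift inside \<open>s\<close>, so that injectivity of
      \<open>s\<close> makes \<open>i\<close> itself a fixed point.\<close>
    have "s ((\<sigma> ^^ m) i) = s i"
      using \<pi> m comp_powers_commute[of "\<sigma> ^^ m" s i] sp by auto
    then have "(\<sigma> ^^ m) i = i"
      using permutes_inj[OF sp(2)] by (simp add: inj_eq)
    then show "\<pi> \<in> S"
      using fixes_i_dvd m shift by (auto elim!: dvdE)
  qed
  moreover have "card stab \<le> card ?C"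
  proof (rule card_inj_on_le)
    show "inj_on ((\<circ>) s) stab"
      using permutes_inj[OF sp(2)] by (auto simp: inj_on_def fun_eq_iff)
    show "(\<circ>) s ` stab \<subseteq> ?C"
      using sp comp_powers by (auto simp: point_stabilizer_def)
    show "finite ?C"
      using finite_powers by simp
  qed
  ultimately have "?C = S"
    using card finS by (intro card_seteq) auto
  moreover have "s i \<in> {1..n}"
    using i_mem sp(2) permutes_in_image by metis
  ultimately show ?thesis
    by blast
qed

lemma strict_EKR_powers: "strict_EKR_property n powers"
  using EKR_powers max_intersecting_coset i_mem unfolding strict_EKR_property_def by blast

end

section \<open>Existence of a shortest cycle and conclusion\<close>

lemma ex_shortest_cycle:
  assumes "n \<ge> 1" "\<sigma> permutes {1..n}"
  shows "\<exists>r i. shortest_cycle n \<sigma> r i"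
proof -
  let ?P = "\<lambda>r. 0 < r \<and> (\<exists>i\<in>{1..n}. (\<sigma> ^^ r) i = i)"
  obtain N where "\<sigma> ^^ N = id" "N > 0"
    using permutation_is_nilpotent assms(2) permutation_permutes by blast
  then have "?P N"
    using assms(1) by auto
  \<comment> \<open>The exponent is minimized over all points at once, which is what yields
    \<open>no_fixpoint\<close> everywhere.\<close>
  then have "?P (LEAST r. ?P r)"
    by (rule LeastI)
  then obtain i where "i \<in> {1..n}" "(\<sigma> ^^ (LEAST r. ?P r)) i = i" "0 < (LEAST r. ?P r)"
    by blast
  then have "shortest_cycle n \<sigma> (LEAST r. ?P r) i"
    using assms(2) not_less_Least[of _ ?P] by unfold_locales blast+
  then show ?thesis
    by blast
qed

theorem theorem5p5:
  fixes n :: nat and \<sigma> :: "nat \<Rightarrow> nat"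
  assumes "n \<ge> 1"
    and "\<sigma> \<in> carrier (sym_group n)"
  shows "strict_EKR_property n (generate (sym_group n) {\<sigma>})"
proof -
  obtain r i where "shortest_cycle n \<sigma> r i"
    using ex_shortest_cycle assms sym_group_carrier by blast
  then show ?thesis
    using shortest_cycle.strict_EKR_powers generate_sym_group_singleton[OF assms(2)] by simp
qed

end
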